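(* The transition to the fundamental limit space, which assigns to each closed injective system $\mathfrak{X}$ its fundamental limit space $\mathcal{L}(\mathfrak{X})$ and to each cis-morphism $\mathfrak{h}:\mathfrak{X}\to\mathfrak{Z}$ its induced fundamental map $\mathcal{L}\mathfrak{h}:\mathcal{L}(\mathfrak{X})\to\mathcal{L}(\mathfrak{Z})$, is a functor from the category $\mathfrak{Cis}$ of closed injective systems and cis-morphisms into the category $\mathfrak{Top}$ of topological spaces and continuous maps.
   Context: $\mathbb{N}=\{0,1,2,\dots\}$. A closed injective system (CIS) $\{X_i,Y_i,f_i\}$ consists, for each $i\in\mathbb{N}$, of a nonempty topological space $X_i$, a closed subspace $Y_i\subset X_i$ and a closed injective continuous map $f_i:Y_i\to X_{i+1}$. Semicomponibility. Each $f_i$ is semicomponible with itself; put $Y_{i,i}=Y_i$, $f_{i,i}=f_i$. For $j>i$, inductively, $f_i$ and $f_j$ are semicomponible if $f_i$ and $f_{j-1}$ are semicomponible and $f_{i,j-1}(Y_{i,j-1})\cap Y_j\neq\emptyset$; in that case $Y_{i,j}=f_{i,j-1}^{-1}(Y_j)$ and $f_{i,j}:Y_{i,j}\to X_{j+1}$ is $f_{i,j}(y)=f_j(f_{i,j-1}(y))$. A limit space for the CIS is a topological space $X$ with continuous maps $\phi_i:X_i\to X$ ($i\in\mathbb{N}$) such that: (1) $X=\bigcup_{i}\phi_i(X_i)$; (2) each $\phi_i$ is an embedding (a homeomorphism onto its image); (3) if $i<j$ and $f_i$, $f_{j-1}$ are semicomponible, then $\phi_i(X_i)\cap\phi_j(X_j)=\phi_j(f_{i,j-1}(Y_{i,j-1}))$,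 and whenever $\phi_i(x_i)=\phi_j(x_j)$ with $x_i\in X_i$, $x_j\in X_j$, one has $x_i\in Y_{i,j-1}$ and $x_j=f_{i,j-1}(x_i)$; (4) if $i<j$ and $f_i$, $f_{j-1}$ are not semicomponible, then $\phi_i(X_i)\cap\phi_j(X_j)=\emptyset$. A fundamental limit space is a limit space $\{X,\phi_i\}$ such that $X$ has the weak topology: a subset $A\subset X$ is closed in $X$ if and only if $\phi_i^{-1}(A)$ is closed in $X_i$ for all $i\in\mathbb{N}$. Every CIS $\mathfrak{X}$ has a fundamental limit space, unique up to homeomorphism compatible with the maps $\phi_i$; it is denoted $\mathcal{L}(\mathfrak{X})=\{X,\phi_i\}$. A cis-morphism $\mathfrak{h}:\mathfrak{X}=\{X_i,Y_i,f_i\}_i\to\mathfrak{Z}=\{Z_i,W_i,g_i\}_i$ is a collection $\mathfrak{h}=\{h_i:X_i\to Z_i\}_{i\in\mathbb{N}}$ of closed continuous maps such that, for all $i$, $h_i(Y_i)\subset W_i$ and $h_{i+1}\circ f_i=g_i\circ h_i|_{Y_i}$. The category $\mathfrak{Cis}$ has closed injective systems as objects and cis-morphisms as morphisms, with componentwise composition and identities. If $\mathcal{L}(\mathfrak{X})=\{X,\phi_i\}$ and $\mathcal{L}(\mathfrak{Z})=\{Z,\psi_i\}$, the fundamental map $\mathcal{L}\mathfrak{h}:X\to Z$ induced by $\mathfrak{h}$ is the unique continuous map with $\mathcal{L}\mathfrak{h}\circ\phi_i=\psi_i\circ h_i$ for all $i\in\mathbb{N}$. *)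

theory Defs
  imports "HOL-Analysis.Analysis"
begin

section \<open>Categories and functors\<close>

text \<open>Composition is indexed by the three objects involved, so hom-sets of different
  pairs of objects need not be disjoint. The composite of \<open>f \<in> Hom a b\<close> and
  \<open>g \<in> Hom b c\<close> is \<open>Comp a b c g f\<close>.\<close>

record ('o, 'm) cat =
  Obj :: "'o set"
  Hom :: "'o \<Rightarrow> 'o \<Rightarrow> 'm set"
  Id :: "'o \<Rightarrow> 'm"
  Comp :: "'o \<Rightarrow> 'o \<Rightarrow> 'o \<Rightarrow> 'm \<Rightarrow> 'm \<Rightarrow> 'm"

locale category =
  fixes C :: "('o, 'm) cat"
  assumes Id_Hom: "a \<in> Obj C \<Longrightarrow> Id C a \<in> Hom C a a"
    and Comp_Hom: "\<lbrakk>a \<in> Obj C; b \<in> Obj C; c \<in> Obj C; f \<in> Hom C a b; g \<in> Hom C b c\<rbrakk>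
      \<Longrightarrow> Comp C a b c g f \<in> Hom C a c"
    and Comp_Id_right: "\<lbrakk>a \<in> Obj C; b \<in> Obj C; f \<in> Hom C a b\<rbrakk>
      \<Longrightarrow> Comp C a a b f (Id C a) = f"
    and Comp_Id_left: "\<lbrakk>a \<in> Obj C; b \<in> Obj C; f \<in> Hom C a b\<rbrakk>
      \<Longrightarrow> Comp C a b b (Id C b) f = f"
    and Comp_assoc: "\<lbrakk>a \<in> Obj C; b \<in> Obj C; c \<in> Obj C; d \<in> Obj C;
        f \<in> Hom C a b; g \<in> Hom C b c; h \<in> Hom C c d\<rbrakk>
      \<Longrightarrow> Comp C a c d h (Comp C a b c g f) = Comp C a b d (Comp C b c d h g) f"

locale cat_functor = C: category C + D: category D
  for C :: "('o, 'm) cat" and D :: "('p, 'n) cat" +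
  fixes F_obj :: "'o \<Rightarrow> 'p"
    and F_arr :: "'o \<Rightarrow> 'o \<Rightarrow> 'm \<Rightarrow> 'n"
  assumes F_Obj: "a \<in> Obj C \<Longrightarrow> F_obj a \<in> Obj D"
    and F_Hom: "\<lbrakk>a \<in> Obj C; b \<in> Obj C; f \<in> Hom C a b\<rbrakk>
      \<Longrightarrow> F_arr a b f \<in> Hom D (F_obj a) (F_obj b)"
    and F_Id: "a \<in> Obj C \<Longrightarrow> F_arr a a (Id C a) = Id D (F_obj a)"
    and F_Comp: "\<lbrakk>a \<in> Obj C; b \<in> Obj C; c \<in> Obj C; f \<in> Hom C a b; g \<in> Hom C b c\<rbrakk>
      \<Longrightarrow> F_arr a c (Comp C a b c g f)
        = Comp D (F_obj a) (F_obj b) (F_obj c) (F_arr b c g) (F_arr a b f)"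


section \<open>The category of topological spaces\<close>

text \<open>Arrows are required to be \<open>extensional\<close> (constantly \<open>undefined\<close> off the domain), so
  that equality of arrows is equality of maps on the carrier. The same convention is used for
  the structure maps of closed injective systems and for their morphisms.\<close>

definition Top_cat :: "('b topology, 'b \<Rightarrow> 'b) cat" where
  "Top_cat = \<lparr>
     Obj = UNIV,
     Hom = (\<lambda>X Y. {f. f \<in> extensional (topspace X) \<and> continuous_map X Y f}),
     Id = (\<lambda>X. \<lambda>x\<in>topspace X. x),
     Comp = (\<lambda>X Y Z g f. compose (topspace X) g f)\<rparr>"


section \<open>Closed injective systems\<close>

text \<open>All the spaces of a system have points in one type \<open>'a\<close>, but are otherwise unrelated.\<close>

record 'a cis =
  sp :: "nat \<Rightarrow> 'a topology"
  sub :: "nat \<Rightarrow> 'a set"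
  mp :: "nat \<Rightarrow> 'a \<Rightarrow> 'a"

definition closed_injective_system :: "'a cis \<Rightarrow> bool" where
  "closed_injective_system S \<longleftrightarrow> (\<forall>i.
     topspace (sp S i) \<noteq> {} \<and>
     closedin (sp S i) (sub S i) \<and>
     mp S i \<in> extensional (sub S i) \<and>
     continuous_map (subtopology (sp S i) (sub S i)) (sp S (Suc i)) (mp S i) \<and>
     closed_map (subtopology (sp S i) (sub S i)) (sp S (Suc i)) (mp S i) \<and>
     inj_on (mp S i) (sub S i))"

text \<open>The following are \<open>f\<^bsub>i,j\<^esub>\<close>, \<open>Y\<^bsub>i,j\<^esub>\<close> and semicomponibility of \<open>f\<^sub>i\<close> and \<open>f\<^sub>j\<close>, by recursion
  on \<open>j\<close> starting at \<open>j = i\<close>. For \<open>j < i\<close> the first two are dummy values and the third is false;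
  \<open>mp_comp S i j\<close> is meaningful only on \<open>sub_comp S i j\<close>, and the latter only if
  \<open>semicomponible S i j\<close> holds.\<close>

primrec mp_comp :: "'a cis \<Rightarrow> nat \<Rightarrow> nat \<Rightarrow> 'a \<Rightarrow> 'a" where
  "mp_comp S i 0 = mp S i"
| "mp_comp S i (Suc j) =
     (if Suc j \<le> i then mp S i else (\<lambda>y. mp S (Suc j) (mp_comp S i j y)))"

primrec sub_comp :: "'a cis \<Rightarrow> nat \<Rightarrow> nat \<Rightarrow> 'a set" where
  "sub_comp S i 0 = sub S i"
| "sub_comp S i (Suc j) =
     (if Suc j \<le> i then sub S i else {y \<in> sub_comp S i j. mp_comp S i j y \<in> sub S (Suc j)})"

primrec semicomponible :: "'a cis \<Rightarrow> nat \<Rightarrow> nat \<Rightarrow> bool" where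
  "semicomponible S i 0 \<longleftrightarrow> i = 0"
| "semicomponible S i (Suc j) \<longleftrightarrow>
     i = Suc j \<or>
     i < Suc j \<and> semicomponible S i j \<and> mp_comp S i j ` sub_comp S i j \<inter> sub S (Suc j) \<noteq> {}"

definition cis_morphism :: "'a cis \<Rightarrow> 'a cis \<Rightarrow> (nat \<Rightarrow> 'a \<Rightarrow> 'a) \<Rightarrow> bool" where
  "cis_morphism S T h \<longleftrightarrow> (\<forall>i.
     h i \<in> extensional (topspace (sp S i)) \<and>
     continuous_map (sp S i) (sp T i) (h i) \<and>
     closed_map (sp S i) (sp T i) (h i) \<and>
     h i ` sub S i \<subseteq> sub T i \<and>
     (\<forall>y \<in> sub S i. h (Suc i) (mp S i y) = mp T i (h i y)))"

definition Cis_cat :: "('a cis, nat \<Rightarrow> 'a \<Rightarrow> 'a) cat" where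
  "Cis_cat = \<lparr>
     Obj = {S. closed_injective_system S},
     Hom = (\<lambda>S T. {h. cis_morphism S T h}),
     Id = (\<lambda>S i. \<lambda>x\<in>topspace (sp S i). x),
     Comp = (\<lambda>S T U g h i. compose (topspace (sp S i)) (g i) (h i))\<rparr>"


section \<open>Fundamental limit spaces and induced maps\<close>

record ('a, 'b) limit_data =
  lim_sp :: "'b topology"
  lim_mp :: "nat \<Rightarrow> 'a \<Rightarrow> 'b"

definition limit_space :: "'a cis \<Rightarrow> ('a, 'b) limit_data \<Rightarrow> bool" where
  "limit_space S L \<longleftrightarrow>
     (\<forall>i. continuous_map (sp S i) (lim_sp L) (lim_mp L i)) \<and>
     topspace (lim_sp L) = (\<Union>i. lim_mp L i ` topspace (sp S i)) \<and>
     (\<forall>i. embedding_map (sp S i) (lim_sp L) (lim_mp L i)) \<and>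
     (\<forall>i j. i < j \<and> semicomponible S i (j - 1) \<longrightarrow>
        lim_mp L i ` topspace (sp S i) \<inter> lim_mp L j ` topspace (sp S j)
          = lim_mp L j ` mp_comp S i (j - 1) ` sub_comp S i (j - 1) \<and>
        (\<forall>x \<in> topspace (sp S i). \<forall>x' \<in> topspace (sp S j). lim_mp L i x = lim_mp L j x' \<longrightarrow>
           x \<in> sub_comp S i (j - 1) \<and> x' = mp_comp S i (j - 1) x)) \<and>
     (\<forall>i j. i < j \<and> \<not> semicomponible S i (j - 1) \<longrightarrow>
        lim_mp L i ` topspace (sp S i) \<inter> lim_mp L j ` topspace (sp S j) = {})"

definition fundamental_limit_space :: "'a cis \<Rightarrow> ('a, 'b) limit_data \<Rightarrow> bool" where
  "fundamental_limit_space S L \<longleftrightarrow>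
     limit_space S L \<and>
     (\<forall>A \<subseteq> topspace (lim_sp L).
        closedin (lim_sp L) A \<longleftrightarrow>
        (\<forall>i. closedin (sp S i) {x \<in> topspace (sp S i). lim_mp L i x \<in> A}))"

text \<open>A fundamental limit space is only unique up to compatible homeomorphism, so the object
  part of the transition to it amounts to a choice of one for every system.\<close>

definition fundamental_limit_choice :: "('a cis \<Rightarrow> ('a, 'b) limit_data) \<Rightarrow> bool" where
  "fundamental_limit_choice L \<longleftrightarrow>
     (\<forall>S. closed_injective_system S \<longrightarrow> fundamental_limit_space S (L S))"

definition is_fundamental_map ::
  "('a cis \<Rightarrow> ('a, 'b) limit_data) \<Rightarrow> 'a cis \<Rightarrow> 'a cis \<Rightarrow> (nat \<Rightarrow> 'a \<Rightarrow> 'a) \<Rightarrow> ('b \<Rightarrow> 'b) \<Rightarrow> bool"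
  where
  "is_fundamental_map L S T h k \<longleftrightarrow>
     k \<in> extensional (topspace (lim_sp (L S))) \<and>
     continuous_map (lim_sp (L S)) (lim_sp (L T)) k \<and>
     (\<forall>i. \<forall>x \<in> topspace (sp S i). k (lim_mp (L S) i x) = lim_mp (L T) i (h i x))"

definition fundamental_map ::
  "('a cis \<Rightarrow> ('a, 'b) limit_data) \<Rightarrow> 'a cis \<Rightarrow> 'a cis \<Rightarrow> (nat \<Rightarrow> 'a \<Rightarrow> 'a) \<Rightarrow> ('b \<Rightarrow> 'b)" where
  "fundamental_map L S T h = (THE k. is_fundamental_map L S T h k)"

end

theory Submission
  imports Defs
begin

text \<open>A point of the limit space is determined by its first appearance in the system: pulling
  \<open>x \<in> X\<^sub>i\<close> back along the injective maps \<open>f\<close> as long as possible ends at a pair \<open>(k, z)\<close> with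
  \<open>z \<in> X\<^sub>k\<close>, and this pair serves as the image of \<open>x\<close>. With the weak topology each \<open>\<phi>\<^sub>i\<close> is a closed
  embedding, because the preimage under \<open>\<phi>\<^sub>j\<close> of the image of a closed set arises by iterated
  preimages under the \<open>f\<close> if \<open>j \<le> i\<close>, and by iterated images under the closed maps \<open>f\<close> if \<open>j \<ge> i\<close>.

  Conversely, in every limit space \<open>\<phi>\<^sub>i(x) = \<phi>\<^sub>j(x')\<close> with \<open>i < j\<close> happens exactly if
  \<open>x' = f\<^bsub>i,j-1\<^esub>(x)\<close>. A morphism of systems preserves this relation, so it descends to the limits;
  the descended map is continuous by the weak topology. Functoriality is uniqueness of that map.\<close>

section \<open>Closed injective systems\<close>

lemma cisD:
  assumes "closed_injective_system S"
  shows cis_closedin_sub: "closedin (sp S i) (sub S i)"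
    and cis_mp_continuous: "continuous_map (subtopology (sp S i) (sub S i)) (sp S (Suc i)) (mp S i)"
    and cis_mp_closed: "closed_map (subtopology (sp S i) (sub S i)) (sp S (Suc i)) (mp S i)"
    and cis_mp_inj: "inj_on (mp S i) (sub S i)"
    and cis_sub_subset: "sub S i \<subseteq> topspace (sp S i)"
  using assms closedin_subset unfolding closed_injective_system_def by blast+

lemma cis_mp_in_topspace:
  assumes "closed_injective_system S" "y \<in> sub S i"
  shows "mp S i y \<in> topspace (sp S (Suc i))"
  using continuous_map_funspace[OF cis_mp_continuous[OF assms(1)], of i]
    cis_sub_subset[OF assms(1)] assms(2) by auto

section \<open>Iterated maps and their domains\<close>

lemma mp_comp_self [simp]: "mp_comp S i i = mp S i"
  by (cases i) auto

lemma sub_comp_self [simp]: "sub_comp S i i = sub S i"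
  by (cases i) auto

lemma mp_comp_step [simp]: "i \<le> j \<Longrightarrow> mp_comp S i (Suc j) y = mp S (Suc j) (mp_comp S i j y)"
  by simp

lemma sub_comp_step [simp]:
  "i \<le> j \<Longrightarrow> sub_comp S i (Suc j) = {y \<in> sub_comp S i j. mp_comp S i j y \<in> sub S (Suc j)}"
  by simp

text \<open>From here on the simplifier unfolds only for \<open>i \<le> j\<close>, so the dummy
  values below the diagonal never enter as case distinctions.\<close>

declare mp_comp.simps(2) [simp del] sub_comp.simps(2) [simp del]

lemma sub_comp_subset: "i \<le> j \<Longrightarrow> sub_comp S i j \<subseteq> sub S i"
  by (induction j rule: dec_induct) auto

lemma mp_comp_in_topspace:
  assumes "closed_injective_system S" "i \<le> j" "y \<in> sub_comp S i j"
  shows "mp_comp S i j y \<in> topspace (sp S (Suc j))"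
  using assms(2,3)
  by (induction j rule: dec_induct) (auto intro: cis_mp_in_topspace[OF assms(1)])

lemma inj_on_mp_comp:
  assumes "closed_injective_system S" "i \<le> j"
  shows "inj_on (mp_comp S i j) (sub_comp S i j)"
  using assms(2)
proof (induction j rule: dec_induct)
  case base
  then show ?case using cis_mp_inj[OF assms(1)] by simp
next
  case (step j)
  then show ?case
    using cis_mp_inj[OF assms(1), of "Suc j"] by (auto simp: inj_on_def)
qed

text \<open>Semicomponibility first fails at an index where the image misses the next subspace; the
  domain becomes empty there and stays empty. Hence having a point in \<open>sub_comp S i j\<close>
  already yields semicomponibility.\<close>

lemma sub_comp_empty_if_not_semicomponible:
  "i \<le> j \<Longrightarrow> \<not> semicomponible S i j \<Longrightarrow> sub_comp S i j = {}"
proof (induction j rule: dec_induct)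
  case base
  then show ?case by (cases i) auto
qed auto

section \<open>Existence of fundamental limit spaces\<close>

text \<open>The stage is kept in the pair because the spaces share the type \<open>'a\<close>:
  points that first appear at different stages must stay distinct. Membership in the carrier is not
  tested, which makes \<open>birth S i\<close> injective on the whole type.\<close>

primrec birth :: "'a cis \<Rightarrow> nat \<Rightarrow> 'a \<Rightarrow> nat \<times> 'a" where
  "birth S 0 x = (0, x)"
| "birth S (Suc i) x =
     (if x \<in> mp S i ` sub S i then birth S i (inv_into (sub S i) (mp S i) x) else (Suc i, x))"

lemma birth_mp:
  assumes "closed_injective_system S" "y \<in> sub S i"
  shows "birth S (Suc i) (mp S i y) = birth S i y"
  using assms cis_mp_inj[OF assms(1)] by simp

lemma fst_birth_le: "fst (birth S i x) \<le> i"
  by (induction i arbitrary: x) (auto intro: le_SucI)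

text \<open>Values of the pull-back branch at stage \<open>Suc i\<close> have first component at
  most \<open>i\<close>, those of the other branch have \<open>Suc i\<close>, so two points with
  equal value take the same branch. The inverse of \<open>mp S i\<close> is injective on the
  image.\<close>

lemma inj_birth:
  assumes "closed_injective_system S"
  shows "inj (birth S i)"
proof (induction i)
  case 0
  then show ?case by (auto simp: inj_def)
next
  case (Suc i)
  show ?case
  proof (rule injI)
    fix x y assume eq: "birth S (Suc i) x = birth S (Suc i) y"
    have le: "birth S i u \<noteq> (Suc i, v)" for u v
      using fst_birth_le[of S i u] by auto
    let ?f = "inv_into (sub S i) (mp S i)"
    let ?I = "mp S i ` sub S i"
    consider "x \<in> ?I" "y \<in> ?I" | "x \<notin> ?I" "y \<notin> ?I"
      using eq le[of "?f x" y] le[of "?f y" x] by (auto split: if_splits)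
    then show "x = y"
    proof cases
      case 1
      then have "?f x = ?f y" using eq injD[OF Suc] by simp
      then show ?thesis using 1 inv_into_injective by metis
    next
      case 2
      then show ?thesis using eq by simp
    qed
  qed
qed

text \<open>A point first appearing at stage \<open>Suc j\<close> would give the value first
  component \<open>Suc j\<close>, but the left side bounds it by \<open>i \<le> j\<close>. So
  \<open>x'\<close> has a preimage under \<open>mp S j\<close>.\<close>

lemma birth_eq_Suc:
  assumes "closed_injective_system S" "i \<le> j" "birth S i x = birth S (Suc j) x'"
  obtains y where "y \<in> sub S j" "x' = mp S j y" "birth S i x = birth S j y"
proof -
  have "x' \<in> mp S j ` sub S j"
  proof (rule ccontr)
    assume "x' \<notin> mp S j ` sub S j"
    then have "fst (birth S i x) = Suc j" using assms(3) by simp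
    then show False using fst_birth_le[of S i x] assms(2) by simp
  qed
  then show thesis using that birth_mp[OF assms(1)] assms(3) by auto
qed

lemma birth_mp_comp:
  assumes "closed_injective_system S" "i \<le> j" "y \<in> sub_comp S i j"
  shows "birth S (Suc j) (mp_comp S i j y) = birth S i y"
  using assms(2,3)
  by (induction j rule: dec_induct) (auto simp: birth_mp[OF assms(1)] simp del: birth.simps)

text \<open>Peeling one map at a time off \<open>x'\<close> leads back to stage \<open>i\<close>,
  where injectivity of \<open>birth S i\<close> identifies what remains with
  \<open>x\<close>.\<close>

lemma birth_eqD:
  assumes "closed_injective_system S" "i \<le> j" "birth S i x = birth S (Suc j) x'"
  shows "x \<in> sub_comp S i j \<and> x' = mp_comp S i j x"
  using assms(2,3)
proof (induction j arbitrary: x' rule: dec_induct)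
  case base
  obtain y where "y \<in> sub S i" "x' = mp S i y" "birth S i x = birth S i y"
    using birth_eq_Suc[OF assms(1) _ base] by blast
  then show ?case using injD[OF inj_birth[OF assms(1)]] by fastforce
next
  case (step j)
  then have "i \<le> Suc j" by simp
  then obtain y where "y \<in> sub S (Suc j)" "x' = mp S (Suc j) y" "birth S i x = birth S (Suc j) y"
    using birth_eq_Suc[OF assms(1) _ step.prems] by blast
  then show ?case using step.IH step.hyps by auto
qed

section \<open>The weak topology of a family of maps\<close>

text \<open>This is the final topology for the maps \<open>p i\<close>, on the union of their
  images.\<close>

definition weak_topology :: "(nat \<Rightarrow> 'a topology) \<Rightarrow> (nat \<Rightarrow> 'a \<Rightarrow> 'b) \<Rightarrow> 'b topology" where
  "weak_topology X p = topology (\<lambda>U. U \<subseteq> (\<Union>i. p i ` topspace (X i)) \<and>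
     (\<forall>i. openin (X i) {x \<in> topspace (X i). p i x \<in> U}))"

lemma openin_weak_topology:
  "openin (weak_topology X p) U \<longleftrightarrow> U \<subseteq> (\<Union>i. p i ` topspace (X i)) \<and>
     (\<forall>i. openin (X i) {x \<in> topspace (X i). p i x \<in> U})"
proof -
  have "istopology (\<lambda>U. U \<subseteq> (\<Union>i. p i ` topspace (X i)) \<and>
     (\<forall>i. openin (X i) {x \<in> topspace (X i). p i x \<in> U}))" (is "istopology ?T")
    unfolding istopology_def
  proof (intro conjI allI impI)
    fix U V i assume "?T U" "?T V"
    then have "openin (X i) ({x \<in> topspace (X i). p i x \<in> U} \<inter> {x \<in> topspace (X i). p i x \<in> V})"
      by blast
    also have "{x \<in> topspace (X i). p i x \<in> U} \<inter> {x \<in> topspace (X i). p i x \<in> V}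
        = {x \<in> topspace (X i). p i x \<in> U \<inter> V}" by auto
    finally show "openin (X i) \<dots>" .
  next
    fix \<U> i assume "\<forall>U\<in>\<U>. ?T U"
    then have "openin (X i) (\<Union>U\<in>\<U>. {x \<in> topspace (X i). p i x \<in> U})" by blast
    also have "(\<Union>U\<in>\<U>. {x \<in> topspace (X i). p i x \<in> U}) = {x \<in> topspace (X i). p i x \<in> \<Union>\<U>}"
      by auto
    finally show "openin (X i) \<dots>" .
  qed blast+
  then show ?thesis unfolding weak_topology_def by (simp add: topology_inverse')
qed

lemma topspace_weak_topology [simp]:
  "topspace (weak_topology X p) = (\<Union>i. p i ` topspace (X i))"
proof
  show "topspace (weak_topology X p) \<subseteq> (\<Union>i. p i ` topspace (X i))"
    using openin_topspace[of "weak_topology X p"] by (simp only: openin_weak_topology)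
  have "{x \<in> topspace (X i). p i x \<in> (\<Union>i. p i ` topspace (X i))} = topspace (X i)" for i
    by blast
  then show "(\<Union>i. p i ` topspace (X i)) \<subseteq> topspace (weak_topology X p)"
    by (intro openin_subset) (simp add: openin_weak_topology)
qed

lemma closedin_weak_topology:
  "closedin (weak_topology X p) A \<longleftrightarrow> A \<subseteq> (\<Union>i. p i ` topspace (X i)) \<and>
     (\<forall>i. closedin (X i) {x \<in> topspace (X i). p i x \<in> A})"
proof -
  have "{x \<in> topspace (X i). p i x \<in> (\<Union>i. p i ` topspace (X i)) - A}
      = topspace (X i) - {x \<in> topspace (X i). p i x \<in> A}" for i by blast
  then show ?thesis by (auto simp: closedin_def openin_weak_topology)
qed

lemma continuous_map_weak_topology: "continuous_map (X i) (weak_topology X p) (p i)"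
  by (auto simp: continuous_map_def openin_weak_topology)

section \<open>Closed embeddings and the limit axioms\<close>

lemma closedin_birth_vimage:
  assumes S: "closed_injective_system S" and C: "closedin (sp S i) C"
  shows "closedin (sp S j) {x \<in> topspace (sp S j). birth S j x \<in> birth S i ` C}"
    (is "closedin _ (?P j)")
proof -
  have CX: "C \<subseteq> topspace (sp S i)" using C closedin_subset by blast
  have base: "?P i = C" using injD[OF inj_birth[OF S]] CX by blast
  show ?thesis
  proof (cases "i \<le> j")
    case True
    then show ?thesis
    proof (induction j rule: dec_induct)
      case base
      then show ?case using \<open>?P i = C\<close> C by simp
    next
      case (step j)
      \<comment> \<open>Going up, \<open>birth_eq_Suc\<close> shows that every point of
        \<open>?P (Suc j)\<close> comes from stage \<open>j\<close>, so the set is an image under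
        the closed map \<open>mp S j\<close>.\<close>
      have "?P (Suc j) = mp S j ` (?P j \<inter> sub S j)"
      proof (intro subset_antisym subsetI)
        fix x assume "x \<in> ?P (Suc j)"
        then obtain c where c: "c \<in> C" "birth S i c = birth S (Suc j) x" by force
        obtain y where "y \<in> sub S j" "x = mp S j y" "birth S i c = birth S j y"
          using birth_eq_Suc[OF S step(1) c(2)] .
        moreover from this have "birth S j y \<in> birth S i ` C" using c(1) by (metis imageI)
        ultimately show "x \<in> mp S j ` (?P j \<inter> sub S j)"
          using cis_sub_subset[OF S] by blast
      next
        fix x assume "x \<in> mp S j ` (?P j \<inter> sub S j)"
        then show "x \<in> ?P (Suc j)"
          using birth_mp[OF S] cis_mp_in_topspace[OF S] by (auto simp del: birth.simps)
      qed
      moreover have "closedin (subtopology (sp S j) (sub S j)) (?P j \<inter> sub S j)"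
        using step.IH closedin_subtopology by blast
      ultimately show ?case
        using cis_mp_closed[OF S, of j] unfolding closed_map_def by presburger
    qed
  next
    case False
    then have "j \<le> i" by simp
    then show ?thesis
    proof (induction j rule: inc_induct)
      case base
      then show ?case using \<open>?P i = C\<close> C by simp
    next
      case (step j)
      \<comment> \<open>Going down, a point sharing its birth with a point of the later stage
        \<open>i\<close> must lie in \<open>sub S j\<close>, so the set is a preimage under
        \<open>mp S j\<close>.\<close>
      have "?P j = {x \<in> topspace (subtopology (sp S j) (sub S j)). mp S j x \<in> ?P (Suc j)}"
      proof (intro subset_antisym subsetI)
        fix x assume x: "x \<in> ?P j"
        then obtain c where c: "c \<in> C" "birth S j x = birth S i c" by force
        obtain i' where i': "i = Suc i'" "j \<le> i'" using step(2) by (cases i) auto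
        have "x \<in> sub_comp S j i'" using birth_eqD[OF S i'(2)] c(2) i'(1) by blast
        then have "x \<in> sub S j" by (rule subsetD[OF sub_comp_subset[OF i'(2)]])
        then show "x \<in> {x \<in> topspace (subtopology (sp S j) (sub S j)). mp S j x \<in> ?P (Suc j)}"
          using x birth_mp[OF S] cis_mp_in_topspace[OF S] by (auto simp del: birth.simps)
      next
        fix x assume "x \<in> {x \<in> topspace (subtopology (sp S j) (sub S j)). mp S j x \<in> ?P (Suc j)}"
        then show "x \<in> ?P j" using birth_mp[OF S] by (auto simp del: birth.simps)
      qed
      then have "closedin (subtopology (sp S j) (sub S j)) (?P j)"
        using closedin_continuous_map_preimage[OF cis_mp_continuous[OF S] step.IH] by simp
      \<comment> \<open>The preimage is closed only in the subspace \<open>sub S j\<close>, which is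
        itself closed in \<open>sp S j\<close>.\<close>
      then show ?case using closedin_trans_full cis_closedin_sub[OF S] by blast
    qed
  qed
qed

lemma fundamental_limit_space_exists:
  fixes S :: "'a cis"
  assumes S: "closed_injective_system S"
  shows "\<exists>L :: ('a, (nat \<times> 'a) set) limit_data. fundamental_limit_space S L"
proof -
  \<comment> \<open>Singletons carry the pairs injectively into the set type chosen for the points
    of the limit.\<close>
  define p where "p i x = {birth S i x}" for i x
  define L where "L = \<lparr>lim_sp = weak_topology (sp S) p, lim_mp = p\<rparr>"
  have L [simp]: "lim_sp L = weak_topology (sp S) p" "lim_mp L = p"
    by (simp_all add: L_def)
  have inj: "inj (p i)" for i
    using inj_birth[OF S, of i] by (auto simp: inj_def p_def)
  have closed: "closed_map (sp S i) (weak_topology (sp S) p) (p i)" for i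
    unfolding closed_map_def closedin_weak_topology
  proof (intro allI impI conjI)
    fix C j assume C: "closedin (sp S i) C"
    then show "p i ` C \<subseteq> (\<Union>i. p i ` topspace (sp S i))"
      using closedin_subset by blast
    have "{x \<in> topspace (sp S j). p j x \<in> p i ` C}
        = {x \<in> topspace (sp S j). birth S j x \<in> birth S i ` C}"
      by (auto simp: p_def)
    then show "closedin (sp S j) {x \<in> topspace (sp S j). p j x \<in> p i ` C}"
      using closedin_birth_vimage[OF S C] by simp
  qed
  have emb: "embedding_map (sp S i) (weak_topology (sp S) p) (p i)" for i
    using injective_closed_imp_embedding_map[OF continuous_map_weak_topology closed]
      inj inj_on_subset by blast
  \<comment> \<open>\<open>eqD\<close> and \<open>eqI\<close> describe the identifications without
    reference to semicomponibility. The index is \<open>j - 1\<close> because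
    \<open>mp_comp S i (j - 1)\<close> takes its values in \<open>sp S j\<close>.\<close>
  have eqD: "x \<in> sub_comp S i (j - 1) \<and> x' = mp_comp S i (j - 1) x"
    if "i < j" "p i x = p j x'" for i j x x'
    using birth_eqD[OF S, of i "j - 1" x x'] that by (cases j) (auto simp: p_def)
  have eqI: "p j (mp_comp S i (j - 1) y) = p i y"
      "mp_comp S i (j - 1) y \<in> topspace (sp S j)" "y \<in> topspace (sp S i)"
    if "i < j" "y \<in> sub_comp S i (j - 1)" for i j y
    using that birth_mp_comp[OF S, of i "j - 1" y] mp_comp_in_topspace[OF S, of i "j - 1" y]
      sub_comp_subset[of i "j - 1" S] cis_sub_subset[OF S, of i]
    by (cases j; auto simp: p_def simp del: birth.simps)+
  have "limit_space S L"
    unfolding limit_space_def L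
  proof (intro conjI allI impI ballI)
    fix i j assume ij: "i < j \<and> semicomponible S i (j - 1)"
    show "p i ` topspace (sp S i) \<inter> p j ` topspace (sp S j)
        = p j ` mp_comp S i (j - 1) ` sub_comp S i (j - 1)"
    proof (intro subset_antisym subsetI)
      fix u assume "u \<in> p i ` topspace (sp S i) \<inter> p j ` topspace (sp S j)"
      then obtain x x' where "u = p i x" "u = p j x'" by blast
      then show "u \<in> p j ` mp_comp S i (j - 1) ` sub_comp S i (j - 1)"
        using eqD[of i j x x'] ij by blast
    next
      fix u assume "u \<in> p j ` mp_comp S i (j - 1) ` sub_comp S i (j - 1)"
      then obtain y where y: "y \<in> sub_comp S i (j - 1)" "u = p j (mp_comp S i (j - 1) y)" by blast
      then show "u \<in> p i ` topspace (sp S i) \<inter> p j ` topspace (sp S j)"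
        using eqI[of i j y] ij by blast
    qed
  next
    fix i j x x' assume "i < j \<and> semicomponible S i (j - 1)" "p i x = p j x'"
    then show "x \<in> sub_comp S i (j - 1)" "x' = mp_comp S i (j - 1) x"
      using eqD[of i j x x'] by blast+
  next
    \<comment> \<open>A common point would lie over an element of
      \<open>sub_comp S i (j - 1)\<close>, which is empty here.\<close>
    fix i j assume ij: "i < j \<and> \<not> semicomponible S i (j - 1)"
    then have "sub_comp S i (j - 1) = {}"
      by (intro sub_comp_empty_if_not_semicomponible) auto
    then show "p i ` topspace (sp S i) \<inter> p j ` topspace (sp S j) = {}"
      using eqD[of i j] ij by blast
  qed (simp_all add: continuous_map_weak_topology emb)
  then have "fundamental_limit_space S L"
    by (simp add: fundamental_limit_space_def closedin_weak_topology)
  then show ?thesis by blast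
qed

section \<open>Induced maps\<close>

lemma limit_spaceD:
  assumes "limit_space S L"
  shows limit_space_continuous: "continuous_map (sp S i) (lim_sp L) (lim_mp L i)"
    and topspace_limit_space: "topspace (lim_sp L) = (\<Union>i. lim_mp L i ` topspace (sp S i))"
    and limit_space_embedding: "embedding_map (sp S i) (lim_sp L) (lim_mp L i)"
    and limit_space_Int: "i < j \<Longrightarrow> semicomponible S i (j - 1) \<Longrightarrow>
      lim_mp L i ` topspace (sp S i) \<inter> lim_mp L j ` topspace (sp S j)
        = lim_mp L j ` mp_comp S i (j - 1) ` sub_comp S i (j - 1)"
    and limit_space_eq_imp: "i < j \<Longrightarrow> semicomponible S i (j - 1) \<Longrightarrow>
      x \<in> topspace (sp S i) \<Longrightarrow> x' \<in> topspace (sp S j) \<Longrightarrow> lim_mp L i x = lim_mp L j x' \<Longrightarrow>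
      x \<in> sub_comp S i (j - 1) \<and> x' = mp_comp S i (j - 1) x"
    and limit_space_disjoint: "i < j \<Longrightarrow> \<not> semicomponible S i (j - 1) \<Longrightarrow>
      lim_mp L i ` topspace (sp S i) \<inter> lim_mp L j ` topspace (sp S j) = {}"
  by (use assms in \<open>simp_all add: limit_space_def\<close>)

text \<open>A common point contradicts the disjointness axiom unless the maps are semicomponible, so
  the intersection axiom applies.\<close>

lemma limit_space_eqD:
  assumes L: "limit_space S L" and ij: "i < j"
    and x: "x \<in> topspace (sp S i)" "x' \<in> topspace (sp S j)" and eq: "lim_mp L i x = lim_mp L j x'"
  shows "x \<in> sub_comp S i (j - 1) \<and> x' = mp_comp S i (j - 1) x"
proof -
  have "lim_mp L i x \<in> lim_mp L i ` topspace (sp S i) \<inter> lim_mp L j ` topspace (sp S j)"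
    using x eq by (metis IntI imageI)
  then have "semicomponible S i (j - 1)"
    using limit_space_disjoint[OF L ij] by blast
  then show ?thesis
    using limit_space_eq_imp[OF L ij _ x eq] by blast
qed

text \<open>Converse of \<open>limit_space_eqD\<close>. The intersection axiom only equates sets and
  gives some \<open>w\<close> in place of \<open>z\<close>; injectivity of the iterated map forces
  \<open>w = z\<close>.\<close>

lemma limit_space_mp_comp:
  assumes S: "closed_injective_system S" and L: "limit_space S L"
    and ij: "i < j" and z: "z \<in> sub_comp S i (j - 1)"
  shows "lim_mp L j (mp_comp S i (j - 1) z) = lim_mp L i z"
proof -
  have le: "i \<le> j - 1" and j: "Suc (j - 1) = j" using ij by simp_all
  have semi: "semicomponible S i (j - 1)"
    using sub_comp_empty_if_not_semicomponible[OF le] z by blast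
  have "lim_mp L i ` topspace (sp S i) \<inter> lim_mp L j ` topspace (sp S j)
      = lim_mp L j ` mp_comp S i (j - 1) ` sub_comp S i (j - 1)"
    by (rule limit_space_Int[OF L ij semi])
  then obtain w where w: "w \<in> topspace (sp S i)"
      "lim_mp L j (mp_comp S i (j - 1) z) = lim_mp L i w"
    using z by blast
  have "mp_comp S i (j - 1) z \<in> topspace (sp S j)"
    using mp_comp_in_topspace[OF S le z] j by simp
  then have "w \<in> sub_comp S i (j - 1) \<and> mp_comp S i (j - 1) z = mp_comp S i (j - 1) w"
    using limit_space_eqD[OF L ij w(1)] w(2) by simp
  then have "w = z" using inj_onD[OF inj_on_mp_comp[OF S le]] z by simp
  then show ?thesis using w(2) by simp
qed

lemma cis_morphism_mp_comp:
  assumes "cis_morphism S T h" "i \<le> j" "y \<in> sub_comp S i j"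
  shows "h i y \<in> sub_comp T i j \<and> mp_comp T i j (h i y) = h (Suc j) (mp_comp S i j y)"
  using assms(2,3)
proof (induction j rule: dec_induct)
  case base
  then show ?case using assms(1) by (auto simp: cis_morphism_def)
next
  case (step j)
  then show ?case using assms(1) by (auto simp: cis_morphism_def)
qed

lemma cis_morphism_in_topspace:
  assumes "cis_morphism S T h" "x \<in> topspace (sp S i)"
  shows "h i x \<in> topspace (sp T i)"
  using assms continuous_map_funspace unfolding cis_morphism_def by blast

text \<open>Well-definedness of the induced map. For \<open>i < j\<close> identified points are
  related by the iterated map, with which \<open>h\<close> commutes; for \<open>i = j\<close> they
  coincide since \<open>lim_mp L i\<close> is injective.\<close>

lemma cis_morphism_respects_limit:
  assumes T: "closed_injective_system T"
    and L: "limit_space S L" and M: "limit_space T M" and h: "cis_morphism S T h"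
    and x: "x \<in> topspace (sp S i)" and x': "x' \<in> topspace (sp S j)"
    and eq: "lim_mp L i x = lim_mp L j x'"
  shows "lim_mp M i (h i x) = lim_mp M j (h j x')"
proof -
  have less: "lim_mp M i (h i x) = lim_mp M j (h j x')"
    if "i < j" "x \<in> topspace (sp S i)" "x' \<in> topspace (sp S j)" "lim_mp L i x = lim_mp L j x'"
    for i j x x'
  proof -
    have "x \<in> sub_comp S i (j - 1)" "x' = mp_comp S i (j - 1) x"
      using limit_space_eqD[OF L that] by blast+
    then have "h i x \<in> sub_comp T i (j - 1)" "mp_comp T i (j - 1) (h i x) = h j x'"
      using cis_morphism_mp_comp[OF h, of i "j - 1" x] that(1) by auto
    then show ?thesis using limit_space_mp_comp[OF T M that(1)] by metis
  qed
  have inj: "inj_on (lim_mp L i) (topspace (sp S i))"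
    using limit_space_embedding[OF L] homeomorphic_imp_injective_map
    unfolding embedding_map_def by blast
  consider "i < j" | "i = j" | "j < i" by linarith
  then show ?thesis
  proof cases
    case 1
    then show ?thesis using less x x' eq by blast
  next
    case 2
    then show ?thesis using inj_onD[OF inj] x x' eq by blast
  next
    case 3
    then show ?thesis using less[of j i x' x] x x' eq by simp
  qed
qed

lemma limit_space_cases:
  assumes "limit_space S L" "u \<in> topspace (lim_sp L)"
  obtains i x where "x \<in> topspace (sp S i)" "u = lim_mp L i x"
  using assms topspace_limit_space[OF assms(1)] by auto

lemma limit_space_in_topspace:
  assumes "limit_space S L" "x \<in> topspace (sp S i)"
  shows "lim_mp L i x \<in> topspace (lim_sp L)"
  using assms topspace_limit_space[OF assms(1)] by auto

section \<open>Construction and uniqueness of the induced map\<close>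

text \<open>Universal property of the weak topology: whether the preimage of a closed set is closed
  is tested in each \<open>sp S i\<close>, on the composite with \<open>lim_mp L i\<close>.\<close>

lemma continuous_map_from_fundamental_limit:
  assumes "fundamental_limit_space S L"
    and "\<And>i. continuous_map (sp S i) Z (\<lambda>x. k (lim_mp L i x))"
  shows "continuous_map (lim_sp L) Z k"
  unfolding continuous_map_closedin
proof (intro conjI ballI allI impI Pi_I)
  have L: "limit_space S L"
    using assms(1) unfolding fundamental_limit_space_def by blast
  show "k u \<in> topspace Z" if "u \<in> topspace (lim_sp L)" for u
    using limit_space_cases[OF L that] continuous_map_funspace[OF assms(2)] by blast
  fix C assume C: "closedin Z C"
  have "{x \<in> topspace (sp S i). lim_mp L i x \<in> {u \<in> topspace (lim_sp L). k u \<in> C}}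
      = {x \<in> topspace (sp S i). k (lim_mp L i x) \<in> C}" for i
    using limit_space_in_topspace[OF L] by blast
  moreover have "closedin (sp S i) {x \<in> topspace (sp S i). k (lim_mp L i x) \<in> C}" for i
    using closedin_continuous_map_preimage[OF assms(2) C] .
  ultimately show "closedin (lim_sp L) {u \<in> topspace (lim_sp L). k u \<in> C}"
    using assms(1) unfolding fundamental_limit_space_def by simp
qed

lemma fundamental_map_ex1:
  assumes choice: "fundamental_limit_choice L"
    and S: "closed_injective_system S" and T: "closed_injective_system T"
    and h: "cis_morphism S T h"
  shows "\<exists>!k. is_fundamental_map L S T h k"
proof (rule ex_ex1I)
  have LS: "fundamental_limit_space S (L S)" and LT: "fundamental_limit_space T (L T)"
    using choice S T unfolding fundamental_limit_choice_def by blast+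
  then have lS: "limit_space S (L S)" and lT: "limit_space T (L T)"
    unfolding fundamental_limit_space_def by blast+
  \<comment> \<open>\<open>P\<close> collects the candidate values over all representatives of
    \<open>u\<close>. They agree by \<open>cis_morphism_respects_limit\<close>, so the choice by
    \<open>SOME\<close> below is forced.\<close>
  define P where "P u v \<longleftrightarrow>
    (\<exists>i x. x \<in> topspace (sp S i) \<and> u = lim_mp (L S) i x \<and> v = lim_mp (L T) i (h i x))" for u v
  define k where "k = (\<lambda>u \<in> topspace (lim_sp (L S)). SOME v. P u v)"
  have k: "k (lim_mp (L S) i x) = lim_mp (L T) i (h i x)" if "x \<in> topspace (sp S i)" for i x
  proof -
    let ?u = "lim_mp (L S) i x"
    have "P ?u (lim_mp (L T) i (h i x))"
      using that unfolding P_def by blast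
    then have "P ?u (SOME v. P ?u v)" by (rule someI)
    then have "(SOME v. P ?u v) = lim_mp (L T) i (h i x)"
      using cis_morphism_respects_limit[OF T lS lT h that] unfolding P_def by metis
    then show ?thesis
      using limit_space_in_topspace[OF lS that] by (simp add: k_def)
  qed
  have "continuous_map (sp S i) (lim_sp (L T)) (\<lambda>x. k (lim_mp (L S) i x))" for i
  proof (rule continuous_map_eq)
    show "continuous_map (sp S i) (lim_sp (L T)) (lim_mp (L T) i \<circ> h i)"
      using h limit_space_continuous[OF lT] unfolding cis_morphism_def
      by (blast intro: continuous_map_compose)
  qed (simp add: k)
  then have "continuous_map (lim_sp (L S)) (lim_sp (L T)) k"
    using continuous_map_from_fundamental_limit[OF LS] by blast
  then show "\<exists>k. is_fundamental_map L S T h k"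
    using k by (auto simp: is_fundamental_map_def k_def)
  fix k1 k2 assume *: "is_fundamental_map L S T h k1" "is_fundamental_map L S T h k2"
  show "k1 = k2"
  \<comment> \<open>The images of the \<open>lim_mp (L S) i\<close> cover the limit space, and off
    it both maps are \<open>undefined\<close>.\<close>
  proof (rule extensionalityI)
    fix u assume "u \<in> topspace (lim_sp (L S))"
    then obtain i x where "x \<in> topspace (sp S i)" "u = lim_mp (L S) i x"
      using limit_space_cases[OF lS] by blast
    then show "k1 u = k2 u" using * by (simp add: is_fundamental_map_def)
  qed (use * in \<open>auto simp: is_fundamental_map_def\<close>)
qed

section \<open>Functoriality\<close>

lemma category_Top_cat: "category Top_cat"
proof
  fix X Y Z :: "'b topology" and f g
  assume f: "f \<in> Hom Top_cat X Y" and g: "g \<in> Hom Top_cat Y Z"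
  \<comment> \<open>\<open>compose\<close> agrees with the plain composite only on the carrier, and
    continuity depends only on values there.\<close>
  have "continuous_map X Z (compose (topspace X) g f)"
    by (rule continuous_map_eq[of _ _ "g \<circ> f"])
      (use f g in \<open>auto simp: Top_cat_def compose_def intro: continuous_map_compose\<close>)
  then show "Comp Top_cat X Y Z g f \<in> Hom Top_cat X Z"
    by (simp add: Top_cat_def)
next
  fix X Y Z W :: "'b topology" and f g h
  assume "f \<in> Hom Top_cat X Y"
  then have "f \<in> topspace X \<rightarrow> topspace Y"
    by (auto simp: Top_cat_def continuous_map_def)
  then show "Comp Top_cat X Z W h (Comp Top_cat X Y Z g f)
      = Comp Top_cat X Y W (Comp Top_cat Y Z W h g) f"
    by (auto simp: Top_cat_def compose_def fun_eq_iff)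
next
  fix X Y :: "'b topology" and f
  assume f: "f \<in> Hom Top_cat X Y"
  then have "f \<in> topspace X \<rightarrow> topspace Y"
    by (auto simp: Top_cat_def continuous_map_def)
  then show "Comp Top_cat X Y Y (Id Top_cat Y) f = f"
    using f by (auto simp: Top_cat_def compose_def fun_eq_iff extensional_def)
  show "Comp Top_cat X X Y f (Id Top_cat X) = f"
    using f by (auto simp: Top_cat_def compose_def fun_eq_iff extensional_def)
qed (auto simp: Top_cat_def intro: continuous_map_eq[OF continuous_map_id])

lemma cis_morphism_Id:
  assumes "closed_injective_system S"
  shows "cis_morphism S S (Id Cis_cat S)"
  unfolding cis_morphism_def
proof (intro allI conjI ballI)
  fix i
  let ?id = "Id Cis_cat S"
  have id: "?id i x = id x" if "x \<in> topspace (sp S i)" for i x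
    using that by (simp add: Cis_cat_def)
  show "continuous_map (sp S i) (sp S i) (?id i)"
    by (rule continuous_map_eq[OF continuous_map_id]) (simp add: id)
  show "closed_map (sp S i) (sp S i) (?id i)"
    by (rule closed_map_eq[of _ _ id]) (simp_all add: id closed_map_def)
  show "?id i ` sub S i \<subseteq> sub S i"
    using id cis_sub_subset[OF assms, of i] by force
  show "?id (Suc i) (mp S i y) = mp S i (?id i y)" if "y \<in> sub S i" for y
    using that id cis_sub_subset[OF assms, of i] cis_mp_in_topspace[OF assms that] by force
qed (simp add: Cis_cat_def)

lemma cis_morphism_Comp:
  assumes S: "closed_injective_system S" and f: "cis_morphism S T f" and g: "cis_morphism T U g"
  shows "cis_morphism S U (Comp Cis_cat S T U g f)"
  unfolding cis_morphism_def
proof (intro allI conjI ballI)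
  fix i
  let ?c = "Comp Cis_cat S T U g f"
  have c: "?c i x = (g i \<circ> f i) x" if "x \<in> topspace (sp S i)" for i x
    using that by (simp add: Cis_cat_def compose_def)
  show "continuous_map (sp S i) (sp U i) (?c i)"
    by (rule continuous_map_eq[of _ _ "g i \<circ> f i"])
      (use f g c in \<open>auto simp: cis_morphism_def intro: continuous_map_compose\<close>)
  show "closed_map (sp S i) (sp U i) (?c i)"
    by (rule closed_map_eq[of _ _ "g i \<circ> f i"])
      (use f g c in \<open>auto simp: cis_morphism_def intro: closed_map_compose\<close>)
  show "?c i ` sub S i \<subseteq> sub U i"
    using f g c cis_sub_subset[OF S, of i] by (fastforce simp: cis_morphism_def)
  show "?c (Suc i) (mp S i y) = mp U i (?c i y)" if y: "y \<in> sub S i" for y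
  proof -
    have "?c (Suc i) (mp S i y) = g (Suc i) (f (Suc i) (mp S i y))"
      using c cis_mp_in_topspace[OF S y] by simp
    also have "\<dots> = g (Suc i) (mp T i (f i y))"
      using f y by (simp add: cis_morphism_def)
    also have "\<dots> = mp U i (g i (f i y))"
      using f g y unfolding cis_morphism_def by blast
    also have "\<dots> = mp U i (?c i y)"
      using c[of y i] y cis_sub_subset[OF S, of i] by auto
    finally show ?thesis .
  qed
qed (simp add: Cis_cat_def)

lemma category_Cis_cat: "category Cis_cat"
proof
  fix S T U V :: "'a cis" and f g h
  assume "f \<in> Hom Cis_cat S T"
  then have "cis_morphism S T f" by (simp add: Cis_cat_def)
  from cis_morphism_in_topspace[OF this]
  show "Comp Cis_cat S U V h (Comp Cis_cat S T U g f)
      = Comp Cis_cat S T V (Comp Cis_cat T U V h g) f"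
    by (auto simp: Cis_cat_def compose_def fun_eq_iff)
next
  fix S T :: "'a cis" and f
  assume "f \<in> Hom Cis_cat S T"
  then have f: "cis_morphism S T f" by (simp add: Cis_cat_def)
  then have ext: "f i \<in> extensional (topspace (sp S i))" for i
    by (simp add: cis_morphism_def)
  show "Comp Cis_cat S T T (Id Cis_cat T) f = f"
    using cis_morphism_in_topspace[OF f] ext
    by (auto simp: Cis_cat_def compose_def fun_eq_iff extensional_def)
  show "Comp Cis_cat S S T f (Id Cis_cat S) = f"
    using ext by (auto simp: Cis_cat_def compose_def fun_eq_iff extensional_def)
next
  fix S :: "'a cis"
  assume "S \<in> Obj Cis_cat"
  then show "Id Cis_cat S \<in> Hom Cis_cat S S"
    using cis_morphism_Id by (simp add: Cis_cat_def)
next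
  fix S T U :: "'a cis" and f g
  assume "S \<in> Obj Cis_cat" "f \<in> Hom Cis_cat S T" "g \<in> Hom Cis_cat T U"
  then show "Comp Cis_cat S T U g f \<in> Hom Cis_cat S U"
    using cis_morphism_Comp[of S T f U g] by (simp add: Cis_cat_def)
qed

section \<open>The functor laws\<close>

lemma cat_functor_fundamental_limit:
  fixes L :: "'a cis \<Rightarrow> ('a, 'b) limit_data"
  assumes L: "fundamental_limit_choice L"
  shows "cat_functor Cis_cat Top_cat (\<lambda>S. lim_sp (L S)) (fundamental_map L)"
proof -
  interpret C: category "Cis_cat :: ('a cis, _) cat" by (rule category_Cis_cat)
  interpret D: category "Top_cat :: ('b topology, _) cat" by (rule category_Top_cat)
  have Obj [simp]: "S \<in> Obj Cis_cat \<longleftrightarrow> closed_injective_system S" for S :: "'a cis"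
    by (simp add: Cis_cat_def)
  have Hom [simp]: "h \<in> Hom Cis_cat S T \<longleftrightarrow> cis_morphism S T h" for S T :: "'a cis" and h
    by (simp add: Cis_cat_def)
  have lim: "limit_space S (L S)" if "closed_injective_system S" for S
    using L that unfolding fundamental_limit_choice_def fundamental_limit_space_def by blast
  have fm: "is_fundamental_map L S T h (fundamental_map L S T h)"
    if "closed_injective_system S" "closed_injective_system T" "cis_morphism S T h" for S T h
    unfolding fundamental_map_def by (rule theI'[OF fundamental_map_ex1[OF L that]])
  \<comment> \<open>Both laws reduce to this: the identity, or the composite of two induced maps, is
    checked to satisfy the defining conditions of the induced map.\<close>
  have fmI: "fundamental_map L S T h = k"
    if "closed_injective_system S" "closed_injective_system T" "cis_morphism S T h"
      "is_fundamental_map L S T h k" for S T h k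
    unfolding fundamental_map_def
    by (rule the1_equality[of "is_fundamental_map L S T h", OF fundamental_map_ex1[OF L that(1-3)] that(4)])
  have fm_Hom: "fundamental_map L S T h \<in> Hom Top_cat (lim_sp (L S)) (lim_sp (L T))"
    if "closed_injective_system S" "closed_injective_system T" "cis_morphism S T h" for S T h
    using fm[OF that] by (simp add: is_fundamental_map_def Top_cat_def)
  show ?thesis
  proof
    fix S :: "'a cis" assume "S \<in> Obj Cis_cat"
    then have S: "closed_injective_system S" by simp
    have "Id Top_cat (lim_sp (L S)) \<in> Hom Top_cat (lim_sp (L S)) (lim_sp (L S))"
      by (rule D.Id_Hom) (simp add: Top_cat_def)
    then have "is_fundamental_map L S S (Id Cis_cat S) (Id Top_cat (lim_sp (L S)))"
      using limit_space_in_topspace[OF lim[OF S]]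
      by (simp add: is_fundamental_map_def Top_cat_def Cis_cat_def)
    then show "fundamental_map L S S (Id Cis_cat S) = Id Top_cat (lim_sp (L S))"
      by (rule fmI[OF S S cis_morphism_Id[OF S]])
  next
    fix S T U :: "'a cis" and f g
    assume "S \<in> Obj Cis_cat" "T \<in> Obj Cis_cat" "U \<in> Obj Cis_cat"
      "f \<in> Hom Cis_cat S T" "g \<in> Hom Cis_cat T U"
    then have S: "closed_injective_system S" and T: "closed_injective_system T"
      and U: "closed_injective_system U" and f: "cis_morphism S T f" and g: "cis_morphism T U g"
      by simp_all
    let ?k = "Comp Top_cat (lim_sp (L S)) (lim_sp (L T)) (lim_sp (L U))
      (fundamental_map L T U g) (fundamental_map L S T f)"
    have "?k \<in> Hom Top_cat (lim_sp (L S)) (lim_sp (L U))"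
      by (rule D.Comp_Hom) (simp_all add: fm_Hom S T U f g, simp_all add: Top_cat_def)
    moreover have "?k (lim_mp (L S) i x) = lim_mp (L U) i (Comp Cis_cat S T U g f i x)"
      if x: "x \<in> topspace (sp S i)" for i x
    proof -
      have "?k (lim_mp (L S) i x)
          = fundamental_map L T U g (fundamental_map L S T f (lim_mp (L S) i x))"
        using limit_space_in_topspace[OF lim[OF S] x] by (simp add: Top_cat_def compose_def)
      also have "\<dots> = lim_mp (L U) i (g i (f i x))"
        using fm[OF S T f] fm[OF T U g] x cis_morphism_in_topspace[OF f x]
        by (simp add: is_fundamental_map_def)
      finally show ?thesis using x by (simp add: Cis_cat_def compose_def)
    qed
    ultimately have "is_fundamental_map L S U (Comp Cis_cat S T U g f) ?k"
      by (simp add: is_fundamental_map_def Top_cat_def)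
    then show "fundamental_map L S U (Comp Cis_cat S T U g f) = ?k"
      by (rule fmI[OF S U cis_morphism_Comp[OF S f g]])
  qed (simp add: Top_cat_def, simp add: fm_Hom)
qed

text \<open>Functoriality is claimed for every choice of limits, with points in any type
  \<open>'b\<close>. The first conjunct provides a choice for one concrete type, so for that type
  the claim is not vacuous.\<close>

theorem corollary6p2:
  shows "(\<exists>L :: 'a cis \<Rightarrow> ('a, (nat \<times> 'a) set) limit_data. fundamental_limit_choice L) \<and>
    (\<forall>L :: 'a cis \<Rightarrow> ('a, 'b) limit_data. fundamental_limit_choice L \<longrightarrow>
       (\<forall>S T h. closed_injective_system S \<and> closed_injective_system T \<and> cis_morphism S T h \<longrightarrow>
          (\<exists>!k. is_fundamental_map L S T h k)) \<and>
       cat_functor Cis_cat Top_cat (\<lambda>S. lim_sp (L S)) (fundamental_map L))"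
proof (intro conjI allI impI)
  show "\<exists>L :: 'a cis \<Rightarrow> ('a, (nat \<times> 'a) set) limit_data. fundamental_limit_choice L"
    unfolding fundamental_limit_choice_def using fundamental_limit_space_exists by metis
qed (use fundamental_map_ex1 cat_functor_fundamental_limit in blast)+

end
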